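(* Let $m\in\mathbb{N}$ and let $K\subset\mathbb{R}^2$ be a polygon with $N$ edges. Define $\widehat{\mathcal A}_{m,N}=(K,\widehat{\mathbb V}_m(K),\widehat\Sigma_K)$ as follows: - if $\mathcal A_{m,N}$ defines a finite element, $\widehat{\mathbb V}_m(K)=\mathbb V_{m,0}(K)\oplus\mathcal S_m^0(\partial K)$ and $\widehat\Sigma_K=\Sigma_{K,0}\cup\Sigma_{\partial K}$; - if $\mathcal A_{m,N}$ does not define a finite element, $\widehat{\mathbb V}_m(K)=\mathbb V_{m,0}(K)\oplus\mathcal S_m^0(\partial K)\oplus\operatorname{span}\{\widetilde f\}$ and $\widehat\Sigma_K=\Sigma_{K,0}\cup\Sigma_{\partial K}\cup\{\mathcal F\}$. Then, in both cases, the triple $\widehat{\mathcal A}_{m,N}$ defines a finite element, i.e. the only $f\in\widehat{\mathbb V}_m(K)$ annihilated by all functionals in $\widehat\Sigma_K$ is $f=0$.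
   Context: A triple (domain, finite-dimensional function space $V$, set of $\dim V$ linear functionals on $V$) "defines a finite element" if the only element of $V$ annihilated by all the functionals is $0$. Boundary objects. $a<b$ are reals; $\omega$ is a weight function on $[a,b]$ (nonnegative, integrable, $\int_a^b\omega>0$, all moments finite); $\{\pi_n\}_{n\ge0}$ are orthogonal polynomials on $[a,b]$ with respect to $\omega$ ($\deg\pi_n=n$, $\int_a^b\pi_m\pi_n\omega\,dx=K_n\delta_{mn}$, $K_n\ne0$), $\{\widehat\pi_n\}$ the orthonormal ones. $K$ has vertices $\mathbf v_1,\dots,\mathbf v_N$ (counter-clockwise, $\mathbf v_{N+1}=\mathbf v_1$), edges $e_i=[\mathbf v_i,\mathbf v_{i+1}]$; $\psi_i(x)=\frac{b-x}{b-a}\mathbf v_i+\frac{x-a}{b-a}\mathbf v_{i+1}$ and $\widetilde\gamma_i(u)(x)=u|_{e_i}(\psi_i(x))$, $x\in[a,b]$. $\mathcal S_m(\partial K)$ is the space of $f\in L^2(\partial K)$ with $f|_{e_i}$ a polynomial of degree at most $m$ for each $i$; $\mathcal S_m^0(\partial K)=\mathcal S_m(\partial K)\cap C^0(\partial K)$, of dimension $mN$. $\{b_j\}_{j=1}^{mN}$ is a basis of $\mathcal S_{m-1}(\partial K)$, $\mathcal L_j(f)=\sum_{i=1}^N\int_a^b\widetilde\gamma_i(f)\widetilde\gamma_i(b_j)\omega\,dx$, $\Sigma_{\partial K}=\{\mathcal L_j\}_{j=1}^{mN}$, $\mathcal A_{m,N}=(\partial K,\mathcal S_m^0(\partial K),\Sigma_{\partial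 K})$. Enrichment (when $\mathcal A_{m,N}$ does not define a finite element). The basis is taken to be an enumeration of functions $b_{\mu\nu}$, $\mu=1,\dots,N$, $\nu=0,\dots,m-1$, with $\widetilde\gamma_i(b_{\mu\nu})=\widehat\pi_\nu\delta_{i\mu}$. There is a nonzero vector $[d_1,\dots,d_{mN}]^T$ such that $\sum_jd_j\mathcal L_j$ vanishes on $\mathcal S_m^0(\partial K)$; enumerate so that $d_1\ne0$ and put $\widetilde f=b_1$. Also $\mathcal F(f)=\sum_{i=1}^N\left(\frac{\pi_m(b)}{\pi_m(a)}\right)^{i-1}\int_a^b\widetilde\gamma_i(f)\pi_m\omega\,dx$. Both $\mathcal L_j$ and $\mathcal F$ act on $\mathcal S_m^0(\partial K)\oplus\operatorname{span}\{\widetilde f\}$ by these formulas. Interior objects. $(K,\mathbb V_m(K),\Sigma_K)$ is the standard Lagrange finite element of degree $m$ on $K$, where $\mathbb V_m(K)$ is a suitable polynomial space on $K$ depending on its geometry. $\mathbb V_{m,0}(K)=\mathbb V_m(K)\cap H_0^1(K)$ is the subspace of functions vanishing on $\partial K$, and $\Sigma_{K,0}=\{\mathcal I'_s:s=1,\dots,S\}\subset\Sigma_K$ is a subset such that $(K,\mathbb V_{m,0}(K),\Sigma_{K,0})$ defines a finite element. Conventions on $\widehat{\mathbb V}_m(K)$. Elements are written uniquely as $f=g_0+p$ (respectively $f=g_0+p+\alpha\widetilde f$) with $g_0\in\mathbb V_{m,0}(K)$, $p\in\mathcal S_m^0(\partial K)$, $\alpha\in\mathbb R$. The functionals $\mathcal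 L_j$ and $\mathcal F$ depend only on boundary values, so they vanish on $\mathbb V_{m,0}(K)$ and act on the remaining component by the formulas above. The $\mathcal I'_s$ are linear functionals on $\widehat{\mathbb V}_m(K)$ which on $\mathbb V_{m,0}(K)$ coincide with the given ones (their values on the boundary components may be arbitrary but linear). *)

theory Defs
  imports "HOL-Analysis.Analysis" "HOL-Library.Function_Algebras"
begin

text \<open>Real-valued functions form a real vector space under the pointwise operations, so that the
  library notions of subspace, span, independence and dimension apply to function spaces.\<close>

instantiation "fun" :: (type, real_vector) real_vector
begin

definition scaleR_fun :: "real \<Rightarrow> ('a \<Rightarrow> 'b) \<Rightarrow> 'a \<Rightarrow> 'b" where
  "scaleR_fun c f = (\<lambda>x. c *\<^sub>R f x)"

instance
  by standard
    (simp_all add: scaleR_fun_def plus_fun_def fun_eq_iff scaleR_right_distrib scaleR_left_distrib)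

end

definition linear_functional_on :: "'a::real_vector set \<Rightarrow> ('a \<Rightarrow> real) \<Rightarrow> bool" where
  "linear_functional_on V L \<longleftrightarrow>
     (\<forall>f\<in>V. \<forall>g\<in>V. L (f + g) = L f + L g) \<and> (\<forall>c. \<forall>f\<in>V. L (c *\<^sub>R f) = c * L f)"

text \<open>The domain of the triple is not an argument: it only records where the elements of \<open>V\<close>
  live. Existence of a finite spanning set is required separately, because \<open>dim\<close> is \<open>0\<close> on
  infinite-dimensional spaces.\<close>

definition defines_finite_element :: "'a::real_vector set \<Rightarrow> ('a \<Rightarrow> real) set \<Rightarrow> bool" where
  "defines_finite_element V \<Sigma> \<longleftrightarrow>
     subspace V \<and> (\<exists>B. finite B \<and> V \<subseteq> span B) \<and>
     finite \<Sigma> \<and> card \<Sigma> = dim V \<and> (\<forall>L\<in>\<Sigma>. linear_functional_on V L) \<and>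
     (\<forall>f\<in>V. (\<forall>L\<in>\<Sigma>. L f = 0) \<longrightarrow> f = 0)"

definition weight_function :: "real \<Rightarrow> real \<Rightarrow> (real \<Rightarrow> real) \<Rightarrow> bool" where
  "weight_function a b \<omega> \<longleftrightarrow>
     (\<forall>x\<in>{a..b}. 0 \<le> \<omega> x) \<and>
     set_integrable lebesgue {a..b} \<omega> \<and>
     0 < (LINT x:{a..b}|lebesgue. \<omega> x) \<and>
     (\<forall>k::nat. set_integrable lebesgue {a..b} (\<lambda>x. x ^ k * \<omega> x))"

definition orthogonal_polys ::
  "real \<Rightarrow> real \<Rightarrow> (real \<Rightarrow> real) \<Rightarrow> (nat \<Rightarrow> real poly) \<Rightarrow> (nat \<Rightarrow> real) \<Rightarrow> bool" where
  "orthogonal_polys a b \<omega> p \<kappa> \<longleftrightarrow>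
     (\<forall>n. degree (p n) = n) \<and> (\<forall>n. \<kappa> n \<noteq> 0) \<and>
     (\<forall>m n. (LINT x:{a..b}|lebesgue. poly (p m) x * poly (p n) x * \<omega> x)
              = (if m = n then \<kappa> n else 0))"

definition orthonormal_polys ::
  "real \<Rightarrow> real \<Rightarrow> (real \<Rightarrow> real) \<Rightarrow> (nat \<Rightarrow> real poly) \<Rightarrow> bool" where
  "orthonormal_polys a b \<omega> p \<longleftrightarrow> orthogonal_polys a b \<omega> p (\<lambda>_. 1)"

text \<open>The vertices are \<open>v 1, \<dots>, v N\<close>, with \<open>v (N + 1) = v 1\<close>.\<close>

definition edge :: "(nat \<Rightarrow> real^2) \<Rightarrow> nat \<Rightarrow> (real^2) set" where
  "edge v i = closed_segment (v i) (v (Suc i))"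

definition polygon_boundary :: "nat \<Rightarrow> (nat \<Rightarrow> real^2) \<Rightarrow> (real^2) set" where
  "polygon_boundary N v = (\<Union>i\<in>{1..N}. edge v i)"

definition polygon_region :: "nat \<Rightarrow> (nat \<Rightarrow> real^2) \<Rightarrow> (real^2) set" where
  "polygon_region N v = polygon_boundary N v \<union> inside (polygon_boundary N v)"

text \<open>The boundary curve is simple (distinct edges meet only in common end points), and it is
  traversed counter-clockwise: the last conjunct says that twice the signed area is positive.\<close>

definition polygon_ccw :: "nat \<Rightarrow> (nat \<Rightarrow> real^2) \<Rightarrow> bool" where
  "polygon_ccw N v \<longleftrightarrow>
     3 \<le> N \<and> v (Suc N) = v 1 \<and> inj_on v {1..N} \<and>
     (\<forall>i\<in>{1..N}. \<forall>j\<in>{1..N}. i \<noteq> j \<longrightarrow>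
        edge v i \<inter> edge v j = {v i, v (Suc i)} \<inter> {v j, v (Suc j)}) \<and>
     0 < (\<Sum>i=1..N. v i $ 1 * v (Suc i) $ 2 - v (Suc i) $ 1 * v i $ 2)"

definition edge_param :: "real \<Rightarrow> real \<Rightarrow> (nat \<Rightarrow> real^2) \<Rightarrow> nat \<Rightarrow> real \<Rightarrow> real^2" where
  "edge_param a b v i x = ((b - x) / (b - a)) *\<^sub>R v i + ((x - a) / (b - a)) *\<^sub>R v (Suc i)"

definition edge_trace ::
  "real \<Rightarrow> real \<Rightarrow> (nat \<Rightarrow> real^2) \<Rightarrow> nat \<Rightarrow> (real^2 \<Rightarrow> real) \<Rightarrow> real \<Rightarrow> real" where
  "edge_trace a b v i f x = f (edge_param a b v i x)"

text \<open>Elements of \<open>S\<^sub>m(\<partial>K)\<close> are classes in \<open>L\<^sup>2(\<partial>K)\<close>, for which the values at the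
  finitely many vertices are immaterial. Each class is represented here by its unique member that
  is polynomial on the half-open edges \<open>[v i, v (i + 1))\<close> (and is extended by zero off the
  boundary), so that equality of classes is equality of functions. A class that contains a
  continuous function is represented by that function.\<close>

definition S_space ::
  "real \<Rightarrow> real \<Rightarrow> nat \<Rightarrow> (nat \<Rightarrow> real^2) \<Rightarrow> nat \<Rightarrow> (real^2 \<Rightarrow> real) set" where
  "S_space a b N v m =
     {f. (\<forall>z. z \<notin> polygon_boundary N v \<longrightarrow> f z = 0) \<and>
         (\<forall>i\<in>{1..N}. \<exists>q :: real poly. degree q \<le> m \<and>
            (\<forall>x\<in>{a..<b}. edge_trace a b v i f x = poly q x))}"

definition S0_space ::
  "real \<Rightarrow> real \<Rightarrow> nat \<Rightarrow> (nat \<Rightarrow> real^2) \<Rightarrow> nat \<Rightarrow> (real^2 \<Rightarrow> real) set" where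
  "S0_space a b N v m =
     {f \<in> S_space a b N v m. continuous_on (polygon_boundary N v) f}"

definition bd_functional ::
  "real \<Rightarrow> real \<Rightarrow> (real \<Rightarrow> real) \<Rightarrow> nat \<Rightarrow> (nat \<Rightarrow> real^2) \<Rightarrow>
     (real^2 \<Rightarrow> real) \<Rightarrow> (real^2 \<Rightarrow> real) \<Rightarrow> real" where
  "bd_functional a b \<omega> N v g f =
     (\<Sum>i=1..N. LINT x:{a..b}|lebesgue. edge_trace a b v i f x * edge_trace a b v i g x * \<omega> x)"

definition extra_functional ::
  "real \<Rightarrow> real \<Rightarrow> (real \<Rightarrow> real) \<Rightarrow> nat \<Rightarrow> (nat \<Rightarrow> real^2) \<Rightarrow> real poly \<Rightarrow>
     (real^2 \<Rightarrow> real) \<Rightarrow> real" where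
  "extra_functional a b \<omega> N v q f =
     (\<Sum>i=1..N. (poly q b / poly q a) ^ (i - 1) *
        (LINT x:{a..b}|lebesgue. edge_trace a b v i f x * poly q x * \<omega> x))"

text \<open>Functions on \<open>K\<close> are extended by zero to the plane.\<close>

definition total_degree_polys :: "(real^2) set \<Rightarrow> nat \<Rightarrow> (real^2 \<Rightarrow> real) set" where
  "total_degree_polys K m =
     span {\<lambda>z. if z \<in> K then z $ 1 ^ i * z $ 2 ^ j else 0 | i j. i + j \<le> m}"

definition node_functionals :: "(real^2) set \<Rightarrow> ((real^2 \<Rightarrow> real) \<Rightarrow> real) set" where
  "node_functionals Z = (\<lambda>z f. f z) ` Z"

text \<open>A space of polynomials on \<open>K\<close> containing all polynomials of total degree at most \<open>m\<close>,
  determined by its values at a finite set \<open>Z\<close> of nodes in \<open>K\<close>. The polynomial space is otherwise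
  left open, since it depends on the shape of \<open>K\<close>.\<close>

definition lagrange_element ::
  "(real^2) set \<Rightarrow> nat \<Rightarrow> (real^2 \<Rightarrow> real) set \<Rightarrow> (real^2) set \<Rightarrow> bool" where
  "lagrange_element K m V Z \<longleftrightarrow>
     finite Z \<and> Z \<subseteq> K \<and> total_degree_polys K m \<subseteq> V \<and>
     (\<forall>f\<in>V. \<exists>p. real_polynomial_function p \<and> f = (\<lambda>z. if z \<in> K then p z else 0)) \<and>
     defines_finite_element V (node_functionals Z)"

definition zero_boundary_space ::
  "nat \<Rightarrow> (nat \<Rightarrow> real^2) \<Rightarrow> (real^2 \<Rightarrow> real) set \<Rightarrow> (real^2 \<Rightarrow> real) set" where
  "zero_boundary_space N v V = {f \<in> V. \<forall>z\<in>polygon_boundary N v. f z = 0}"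

text \<open>An element of the combined space is a pair of an interior function and a boundary function.
  The direct sum of an interior and a boundary space is thus their Cartesian product.\<close>

type_synonym combined = "(real^2 \<Rightarrow> real) \<times> (real^2 \<Rightarrow> real)"

definition combined_space ::
  "(real^2 \<Rightarrow> real) set \<Rightarrow> (real^2 \<Rightarrow> real) set \<Rightarrow> combined set" where
  "combined_space V0 W = V0 \<times> W"

definition enriched_space ::
  "(real^2 \<Rightarrow> real) set \<Rightarrow> (real^2 \<Rightarrow> real) \<Rightarrow> (real^2 \<Rightarrow> real) set" where
  "enriched_space W g = {p + \<alpha> *\<^sub>R g | p \<alpha>. p \<in> W}"

definition on_boundary :: "((real^2 \<Rightarrow> real) \<Rightarrow> real) \<Rightarrow> combined \<Rightarrow> real" where
  "on_boundary L f = L (snd f)"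

text \<open>\<open>J 1, \<dots>, J S\<close> are arbitrary linear extensions to the combined space \<open>X\<close> of the
  functionals \<open>I 1, \<dots>, I S\<close> on the interior space \<open>V0\<close>.\<close>

definition extends_interior ::
  "nat \<Rightarrow> (real^2 \<Rightarrow> real) set \<Rightarrow> combined set \<Rightarrow>
     (nat \<Rightarrow> (real^2 \<Rightarrow> real) \<Rightarrow> real) \<Rightarrow> (nat \<Rightarrow> combined \<Rightarrow> real) \<Rightarrow> bool" where
  "extends_interior S V0 X I J \<longleftrightarrow>
     (\<forall>s\<in>{1..S}. linear_functional_on X (J s) \<and> (\<forall>g\<in>V0. J s (g, 0) = I s g))"

end

theory Submission
  imports Defs
begin

text \<open>The functionals on the combined space are triangular: those on the boundary do not see the
  interior component, so they force the boundary component of an annihilated element to vanish,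
  after which the interior functionals act as on the interior element alone
  (\<open>defines_finite_element_combined\<close>). This reduces both cases to the boundary element; in the first
  case nothing remains to be shown.

  In the second case let \<open>f = g + \<alpha> *\<^sub>R bas 1\<close>, with \<open>g\<close> continuous, be annihilated by all
  boundary functionals. The basis is orthonormal, so \<open>L j (bas 1)\<close> is \<open>1\<close> for \<open>j = 1\<close> and \<open>0\<close>
  otherwise. The combination \<open>\<Sum>j. d j * L j\<close> vanishes on \<open>g\<close>, hence \<open>0 = \<alpha> * d 1\<close> and \<open>\<alpha> = 0\<close>.
  Each piece of \<open>g\<close> is now orthogonal to all polynomials of degree below \<open>m\<close>, so it is a multiple
  \<open>c i\<close> of \<open>\<pi> m\<close>. As \<open>\<pi> m\<close> does not vanish at the end point \<open>a\<close>
  (\<open>orthogonal_poly_endpoint_nonzero\<close>), continuity at the vertices makes \<open>c\<close> a geometric sequence of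
  ratio \<open>\<pi> m (b) / \<pi> m (a)\<close>. With the same weights, the extra functional becomes \<open>c 1\<close> times a
  nonzero number, and therefore \<open>c = 0\<close> (\<open>S0_space_eq_0_if_moments_vanish\<close>).

  It remains to compare the dimension with the number of functionals. Unisolvence bounds the
  dimension from above (\<open>unisolvent_imp_finite_span\<close>), so only independent families of the right size
  have to be exhibited. On the boundary such a family is obtained by an injective linear map from
  discontinuous piecewise polynomials of degree at most \<open>m - 1\<close> into continuous ones of degree at
  most \<open>m\<close>
  (\<open>continuous_lift\<close>), together with \<open>bas 1\<close>, which is not in the continuous space since the
  relation \<open>d\<close> does not vanish on it.\<close>

section \<open>Unisolvence and dimension\<close>

lemma linear_functional_on_subset:
  "linear_functional_on W L \<Longrightarrow> V \<subseteq> W \<Longrightarrow> linear_functional_on V L"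
  unfolding linear_functional_on_def by blast

lemma linear_functional_on_diff_scaleR:
  assumes "linear_functional_on V L" "subspace V" "f \<in> V" "g \<in> V"
  shows "L (f - c *\<^sub>R g) = L f - c * L g"
proof -
  have "L (f + (- c) *\<^sub>R g) = L f + (- c) * L g"
    using assms subspace_scale[of V g "- c"] unfolding linear_functional_on_def by metis
  then show ?thesis by simp
qed

lemma linear_functional_on_zero:
  assumes "linear_functional_on V L" "subspace V"
  shows "L 0 = 0"
proof -
  have "L (0 *\<^sub>R 0) = 0 * L 0"
    using assms subspace_0[of V] unfolding linear_functional_on_def by blast
  then show ?thesis by simp
qed

text \<open>Imposing the vanishing of one functional lowers the dimension by at most one, so the size of
  a unisolvent family bounds the dimension. Finite-dimensionality of \<open>V\<close> is a conclusion here.\<close>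

lemma unisolvent_imp_finite_span:
  fixes V :: "'a::real_vector set"
  assumes "finite \<Sigma>" "subspace V" "\<forall>L\<in>\<Sigma>. linear_functional_on V L"
    "\<forall>f\<in>V. (\<forall>L\<in>\<Sigma>. L f = 0) \<longrightarrow> f = 0"
  shows "\<exists>B. finite B \<and> card B \<le> card \<Sigma> \<and> V \<subseteq> span B"
  using assms
proof (induction \<Sigma> arbitrary: V rule: finite_induct)
  case empty
  then show ?case by (intro exI[of _ "{}"]) auto
next
  case (insert L \<Sigma>)
  have lin: "linear_functional_on V L" using insert.prems by blast
  define V' where "V' = {f\<in>V. L f = 0}"
  have sub: "subspace V'"
    using insert.prems(1) lin linear_functional_on_zero[OF lin]
    by (auto simp: subspace_def V'_def linear_functional_on_def)
  have "\<forall>M\<in>\<Sigma>. linear_functional_on V' M"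
    using insert.prems(2) linear_functional_on_subset[of V _ V'] by (auto simp: V'_def)
  moreover have "\<forall>f\<in>V'. (\<forall>M\<in>\<Sigma>. M f = 0) \<longrightarrow> f = 0"
    using insert.prems(3) by (auto simp: V'_def)
  ultimately obtain B where B: "finite B" "card B \<le> card \<Sigma>" "V' \<subseteq> span B"
    using insert.IH[OF sub] by blast
  show ?case
  proof (cases "\<exists>u\<in>V. L u \<noteq> 0")
    case False
    then have "V \<subseteq> span B" using B by (auto simp: V'_def)
    then show ?thesis using B insert.hyps by (intro exI[of _ B]) auto
  next
    case True
    then obtain u where u: "u \<in> V" "L u \<noteq> 0" by blast
    have "f \<in> span (insert u B)" if f: "f \<in> V" for f
    proof -
      have "L (f - (L f / L u) *\<^sub>R u) = 0"
        using linear_functional_on_diff_scaleR[OF lin insert.prems(1) f u(1)] u(2) by simp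
      moreover have "f - (L f / L u) *\<^sub>R u \<in> V"
        by (intro subspace_diff subspace_scale insert.prems f u)
      ultimately have "f - (L f / L u) *\<^sub>R u \<in> span B"
        using B by (auto simp: V'_def)
      then show ?thesis using span_breakdown_eq by blast
    qed
    then have "V \<subseteq> span (insert u B)" by blast
    moreover have "card (insert u B) \<le> card (insert L \<Sigma>)"
      using B insert.hyps card_insert_le_m1[of "Suc (card \<Sigma>)" B u] by simp
    ultimately show ?thesis using B(1) by (intro exI[of _ "insert u B"]) auto
  qed
qed

text \<open>With a unisolvent family of functionals, the dimension need only be bounded from below, by
  an independent family of the same size.\<close>

lemma defines_finite_elementI:
  assumes "subspace V" "finite \<Sigma>" "\<forall>L\<in>\<Sigma>. linear_functional_on V L"
    "\<forall>f\<in>V. (\<forall>L\<in>\<Sigma>. L f = 0) \<longrightarrow> f = 0"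
    and A: "independent A" "A \<subseteq> V" "card \<Sigma> \<le> card A"
  shows "defines_finite_element V \<Sigma>"
proof -
  obtain B where B: "finite B" "card B \<le> card \<Sigma>" "V \<subseteq> span B"
    using unisolvent_imp_finite_span[of \<Sigma> V] assms by blast
  obtain C where C: "C \<subseteq> V" "independent C" "V \<subseteq> span C" "card C = dim V"
    by (rule basis_exists)
  have "finite C" using independent_span_bound[OF B(1) C(2)] C(1) B(3) by blast
  then have "card A \<le> dim V"
    using independent_span_bound[OF _ A(1), of C] A(2) C by (metis subset_trans)
  moreover have "dim V \<le> card \<Sigma>"
    using dim_le_card[OF B(3,1)] B(2) by simp
  ultimately have "card \<Sigma> = dim V" using A(3) by simp
  then show ?thesis unfolding defines_finite_element_def using assms B by blast
qed

lemma defines_finite_element_basis: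
  assumes "defines_finite_element V \<Sigma>"
  obtains B where "finite B" "independent B" "B \<subseteq> V" "card B = card \<Sigma>"
proof -
  obtain T where T: "finite T" "V \<subseteq> span T"
    using assms by (auto simp: defines_finite_element_def)
  obtain C where C: "C \<subseteq> V" "independent C" "V \<subseteq> span C" "card C = dim V"
    by (rule basis_exists)
  have "finite C" using independent_span_bound[OF T(1) C(2)] C(1) T(2) by blast
  then show ?thesis using that C assms by (auto simp: defines_finite_element_def)
qed

lemma independent_Times:
  fixes A :: "'a::real_vector set" and B :: "'b::real_vector set"
  assumes "finite A" "independent A" "finite B" "independent B"
  shows "independent ((\<lambda>x. (x, 0)) ` A \<union> (\<lambda>y. (0, y)) ` B)"
    and "card ((\<lambda>x. (x, 0 :: 'b)) ` A \<union> (\<lambda>y. (0 :: 'a, y)) ` B) = card A + card B"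
proof -
  let ?A = "(\<lambda>x. (x, 0 :: 'b)) ` A" and ?B = "(\<lambda>y. (0 :: 'a, y)) ` B"
  have nz: "0 \<notin> A" "0 \<notin> B" using assms dependent_zero by blast+
  have disj: "?A \<inter> ?B = {}" using nz by auto
  have injs: "inj_on (\<lambda>x. (x, 0 :: 'b)) A" "inj_on (\<lambda>y. (0 :: 'a, y)) B"
    by (auto simp: inj_on_def)
  show "card (?A \<union> ?B) = card A + card B"
    using card_Un_disjoint[OF _ _ disj] assms injs by (simp add: card_image)
  show "independent (?A \<union> ?B)"
  proof (rule independent_if_scalars_zero)
    show "finite (?A \<union> ?B)" using assms by simp
    fix c :: "'a \<times> 'b \<Rightarrow> real" and x
    assume s: "(\<Sum>x\<in>?A \<union> ?B. c x *\<^sub>R x) = 0" and x: "x \<in> ?A \<union> ?B"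
    have "(\<Sum>x\<in>?A \<union> ?B. c x *\<^sub>R x) = (\<Sum>x\<in>?A. c x *\<^sub>R x) + (\<Sum>x\<in>?B. c x *\<^sub>R x)"
      using assms disj by (intro sum.union_disjoint) auto
    also have "\<dots> = (\<Sum>x\<in>A. c (x, 0) *\<^sub>R (x, 0)) + (\<Sum>y\<in>B. c (0, y) *\<^sub>R (0, y))"
      by (simp add: sum.reindex injs)
    finally have "fst ((\<Sum>x\<in>A. c (x, 0) *\<^sub>R (x, 0)) + (\<Sum>y\<in>B. c (0, y) *\<^sub>R (0, y))) = 0"
      "snd ((\<Sum>x\<in>A. c (x, 0) *\<^sub>R (x, 0)) + (\<Sum>y\<in>B. c (0, y) *\<^sub>R (0, y))) = 0"
      using s by (metis fst_zero, metis snd_zero)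
    then have "(\<Sum>x\<in>A. c (x, 0) *\<^sub>R x) = 0" "(\<Sum>y\<in>B. c (0, y) *\<^sub>R y) = 0"
      by (simp_all add: fst_sum snd_sum)
    then have "\<forall>x\<in>A. c (x, 0) = 0" "\<forall>y\<in>B. c (0, y) = 0"
      using independentD[OF assms(2,1) subset_refl, of "\<lambda>x. c (x, 0)"]
        independentD[OF assms(4,3) subset_refl, of "\<lambda>y. c (0, y)"] by simp_all
    then show "c x = 0" using x by auto
  qed
qed

text \<open>The values of the extended interior functionals on the boundary component do not matter:
  the boundary functionals force that component to vanish first.\<close>

lemma defines_finite_element_combined:
  assumes V0: "defines_finite_element V0 (I ` {1..S})"
    and W: "defines_finite_element W \<Lambda>"
    and J: "extends_interior S V0 (combined_space V0 W) I J" and inj: "inj_on I {1..S}"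
  shows "defines_finite_element (combined_space V0 W) (J ` {1..S} \<union> on_boundary ` \<Lambda>)"
proof -
  let ?\<Sigma> = "J ` {1..S} \<union> on_boundary ` \<Lambda>"
  have sub: "subspace V0" "subspace W" and fin: "finite \<Lambda>"
    using V0 W by (auto simp: defines_finite_element_def)
  have Jlin: "linear_functional_on (combined_space V0 W) (J s)"
    and JI: "\<And>g. g \<in> V0 \<Longrightarrow> J s (g, 0) = I s g" if "s \<in> {1..S}" for s
    using J that by (auto simp: extends_interior_def)
  obtain A where A: "finite A" "independent A" "A \<subseteq> V0" "card A = S"
    using defines_finite_element_basis[OF V0] inj by (metis card_image card_atLeastAtMost diff_Suc_1)
  obtain B where B: "finite B" "independent B" "B \<subseteq> W" "card B = card \<Lambda>"
    using defines_finite_element_basis[OF W] by blast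
  show ?thesis
  proof (rule defines_finite_elementI)
    show "subspace (combined_space V0 W)"
      unfolding combined_space_def by (rule subspace_Times[OF sub])
    show "finite ?\<Sigma>" using fin by simp
    show "\<forall>L\<in>?\<Sigma>. linear_functional_on (combined_space V0 W) L"
      using Jlin W
      by (auto simp: on_boundary_def linear_functional_on_def defines_finite_element_def
          combined_space_def)
    show "\<forall>f\<in>combined_space V0 W. (\<forall>L\<in>?\<Sigma>. L f = 0) \<longrightarrow> f = 0"
    proof (intro ballI impI)
      fix f assume f: "f \<in> combined_space V0 W" and z: "\<forall>L\<in>?\<Sigma>. L f = 0"
      obtain g p where gp: "f = (g, p)" "g \<in> V0" "p \<in> W"
        using f by (auto simp: combined_space_def)
      have "L p = 0" if "L \<in> \<Lambda>" for L
        using bspec[OF z, of "on_boundary L"] that by (simp add: on_boundary_def gp(1))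
      then have p: "p = 0" using W gp by (auto simp: defines_finite_element_def)
      have "I s g = 0" if "s \<in> {1..S}" for s
        using bspec[OF z, of "J s"] JI[OF that gp(2)] that by (simp add: gp(1) p)
      then have "g = 0" using V0 gp by (auto simp: defines_finite_element_def)
      then show "f = 0" using gp p by (simp add: zero_prod_def)
    qed
    show "independent ((\<lambda>x. (x, 0)) ` A \<union> (\<lambda>y. (0, y)) ` B)"
      by (rule independent_Times(1)[OF A(1,2) B(1,2)])
    show "(\<lambda>x. (x, 0)) ` A \<union> (\<lambda>y. (0, y)) ` B \<subseteq> combined_space V0 W"
      using A(3) B(3) subspace_0[OF sub(1)] subspace_0[OF sub(2)]
      by (auto simp: combined_space_def)
    have "card ?\<Sigma> \<le> card (J ` {1..S}) + card (on_boundary ` \<Lambda>)" by (rule card_Un_le)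
    also have "\<dots> \<le> S + card \<Lambda>"
      using card_image_le[of "{1..S}" J] card_image_le[OF fin, of on_boundary]
      by (intro add_mono) auto
    finally show "card ?\<Sigma> \<le> card ((\<lambda>x. (x, 0)) ` A \<union> (\<lambda>y. (0, y)) ` B)"
      using independent_Times(2)[OF A(1,2) B(1,2)] A(4) B(4) by simp
  qed
qed

section \<open>Orthogonal polynomials\<close>

text \<open>The weighted inner product of \<open>p\<close> and \<open>q\<close> is the weighted integral of \<open>p * q\<close>.\<close>

definition weighted_integral :: "real \<Rightarrow> real \<Rightarrow> (real \<Rightarrow> real) \<Rightarrow> real poly \<Rightarrow> real" where
  "weighted_integral a b \<omega> p = (LINT x:{a..b}|lebesgue. poly p x * \<omega> x)"

locale weighted_interval =
  fixes a b :: real and \<omega> :: "real \<Rightarrow> real"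
  assumes ab: "a < b" and weight: "weight_function a b \<omega>"
begin

lemma set_integrable_poly_weight: "set_integrable lebesgue {a..b} (\<lambda>x. poly p x * \<omega> x)"
proof -
  have *: "set_integrable lebesgue {a..b} (\<lambda>x. coeff p i * (x ^ i * \<omega> x))" for i
    using weight by (auto simp: weight_function_def)
  have "set_integrable lebesgue {a..b} (\<lambda>x. \<Sum>i\<le>degree p. coeff p i * (x ^ i * \<omega> x))"
    unfolding set_integrable_def scaleR_sum_right
    by (rule Bochner_Integration.integrable_sum) (use * in \<open>simp only: set_integrable_def\<close>)
  then show ?thesis by (simp add: poly_altdef sum_distrib_right mult.assoc)
qed

lemma weighted_integral_add:
  "weighted_integral a b \<omega> (p + q) = weighted_integral a b \<omega> p + weighted_integral a b \<omega> q"
  unfolding weighted_integral_def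
  using set_integral_add(2)[OF set_integrable_poly_weight set_integrable_poly_weight, of p q]
  by (simp add: distrib_right)

lemma weighted_integral_smult:
  "weighted_integral a b \<omega> (smult c p) = c * weighted_integral a b \<omega> p"
  unfolding weighted_integral_def by (simp add: mult.assoc)

lemma weighted_integral_0 [simp]: "weighted_integral a b \<omega> 0 = 0"
  by (simp add: weighted_integral_def)

lemma weighted_integral_diff:
  "weighted_integral a b \<omega> (p - q) = weighted_integral a b \<omega> p - weighted_integral a b \<omega> q"
  using weighted_integral_add[of p "smult (-1) q"] weighted_integral_smult[of "-1" q] by simp

text \<open>The weight may vanish on large sets, but not almost everywhere, whereas a nonzero polynomial
  has finitely many zeros.\<close>

lemma weighted_integral_nonneg_eq_0:
  assumes nonneg: "\<And>x. x \<in> {a..b} \<Longrightarrow> 0 \<le> poly p x" and zero: "weighted_integral a b \<omega> p = 0"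
  shows "p = 0"
proof (rule ccontr)
  assume p: "p \<noteq> 0"
  let ?f = "\<lambda>x. indicator {a..b} x *\<^sub>R (poly p x * \<omega> x)"
  have int: "integrable lebesgue ?f"
    using set_integrable_poly_weight by (simp add: set_integrable_def)
  have "AE x in lebesgue. 0 \<le> ?f x"
    using nonneg weight by (auto simp: weight_function_def indicator_def)
  then have 1: "AE x in lebesgue. ?f x = 0"
    using integral_nonneg_eq_0_iff_AE[OF int] zero
    by (simp add: weighted_integral_def set_lebesgue_integral_def)
  have "negligible {x. poly p x = 0}" using poly_roots_finite[OF p] by (rule negligible_finite)
  then have 2: "AE x in lebesgue. poly p x \<noteq> 0"
    by (auto simp: negligible_iff_null_sets intro: AE_I')
  have "AE x in lebesgue. indicator {a..b} x *\<^sub>R \<omega> x = 0"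
    using 1 2 by eventually_elim auto
  then have "(LINT x:{a..b}|lebesgue. \<omega> x) = 0"
    unfolding set_lebesgue_integral_def by (rule integral_eq_zero_AE)
  then show False using weight by (simp add: weight_function_def)
qed

lemma orthogonal_polysD:
  assumes "orthogonal_polys a b \<omega> p \<kappa>"
  shows "degree (p n) = n"
    and "weighted_integral a b \<omega> (p k * p n) = (if k = n then \<kappa> n else 0)"
    and "\<kappa> n \<noteq> 0" and "coeff (p n) n \<noteq> 0"
proof -
  show d: "degree (p n) = n" for n using assms by (auto simp: orthogonal_polys_def)
  show w: "weighted_integral a b \<omega> (p k * p n) = (if k = n then \<kappa> n else 0)" for k n
    using assms by (auto simp: orthogonal_polys_def weighted_integral_def)
  show k: "\<kappa> n \<noteq> 0" using assms by (auto simp: orthogonal_polys_def)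
  have "p n \<noteq> 0" using w[of n n] k by auto
  then show "coeff (p n) n \<noteq> 0" using d leading_coeff_0_iff by metis
qed

text \<open>The bound on the degree of \<open>r\<close> is expressed by its coefficients so as to include \<open>r = 0\<close>
  when \<open>m = 0\<close>.\<close>

lemma orthogonal_to_lower_degree:
  assumes p: "orthogonal_polys a b \<omega> p \<kappa>"
    and q: "\<And>k. k < m \<Longrightarrow> weighted_integral a b \<omega> (q * p k) = 0"
    and r: "\<And>k. k \<ge> m \<Longrightarrow> coeff r k = 0"
  shows "weighted_integral a b \<omega> (q * r) = 0"
proof -
  have "n \<le> m \<Longrightarrow> (\<And>k. k \<ge> n \<Longrightarrow> coeff r k = 0) \<Longrightarrow> weighted_integral a b \<omega> (q * r) = 0" for n r
  proof (induction n arbitrary: r)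
    case 0
    then have "r = 0" by (intro poly_eqI) simp
    then show ?case by simp
  next
    case (Suc n)
    define c where "c = coeff r n / coeff (p n) n"
    define r' where "r' = r - smult c (p n)"
    have "coeff r' k = 0" if "k \<ge> n" for k
    proof (cases "k = n")
      case True
      then show ?thesis using orthogonal_polysD(4)[OF p] by (simp add: r'_def c_def)
    next
      case False
      then show ?thesis
        using that Suc.prems(2)[of k] orthogonal_polysD(1)[OF p, of n]
        by (simp add: r'_def coeff_eq_0)
    qed
    then have "weighted_integral a b \<omega> (q * r') = 0" using Suc by simp
    moreover have "q * r = q * r' + smult c (q * p n)" by (simp add: r'_def algebra_simps)
    ultimately show ?case
      using q[of n] Suc.prems(1) by (simp add: weighted_integral_add weighted_integral_smult)
  qed
  then show ?thesis using r by blast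
qed

text \<open>If \<open>p n = (x - c) q\<close> with \<open>c\<close> an end point, then \<open>(x - c) q\<^sup>2\<close> has constant sign on
  \<open>[a, b]\<close> and, by orthogonality, weighted integral zero.\<close>

lemma orthogonal_poly_endpoint_nonzero:
  assumes p: "orthogonal_polys a b \<omega> p \<kappa>" and c: "c = a \<or> c = b"
  shows "poly (p n) c \<noteq> 0"
proof
  assume "poly (p n) c = 0"
  then obtain q where q: "p n = [:- c, 1:] * q" by (metis dvdE poly_eq_0_iff_dvd)
  have pn: "p n \<noteq> 0" using orthogonal_polysD(4)[OF p, of n] by auto
  then have q0: "q \<noteq> 0" using q by auto
  have deg: "n = Suc (degree q)"
    using orthogonal_polysD(1)[OF p, of n] q q0 by (simp add: degree_mult_eq del: mult_pCons_left)
  have W: "weighted_integral a b \<omega> (p n * q) = 0"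
    by (rule orthogonal_to_lower_degree[OF p, where m = n])
      (use deg orthogonal_polysD(2)[OF p] in \<open>auto intro: coeff_eq_0\<close>)
  define s :: real where "s = (if c = a then 1 else - 1)"
  have "smult s (p n * q) = 0"
  proof (rule weighted_integral_nonneg_eq_0)
    show "weighted_integral a b \<omega> (smult s (p n * q)) = 0" by (simp add: weighted_integral_smult W)
    fix x assume x: "x \<in> {a..b}"
    have "poly (smult s (p n * q)) x = (s * (x - c)) * (poly q x)\<^sup>2"
      by (simp add: q power2_eq_square algebra_simps)
    moreover have "0 \<le> s * (x - c)" using x c by (auto simp: s_def)
    ultimately show "0 \<le> poly (smult s (p n * q)) x" by (metis mult_nonneg_nonneg zero_le_power2)
  qed
  then show False using pn q0 by (auto simp: s_def split: if_splits)
qed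

text \<open>Subtracting from \<open>q\<close> the multiple of \<open>\<pi> m\<close> with the same coefficient of degree \<open>m\<close> leaves a
  remainder of lower degree that is orthogonal to itself.\<close>

lemma orthogonal_to_lower_degree_imp_multiple:
  assumes \<pi>: "orthogonal_polys a b \<omega> \<pi> \<kappa>" and p: "orthogonal_polys a b \<omega> p \<kappa>'"
    and q: "degree q \<le> m" "\<And>k. k < m \<Longrightarrow> weighted_integral a b \<omega> (q * p k) = 0"
  shows "\<exists>c. q = smult c (\<pi> m)"
proof -
  define c where "c = coeff q m / coeff (\<pi> m) m"
  define r where "r = q - smult c (\<pi> m)"
  have r: "coeff r k = 0" if "k \<ge> m" for k
  proof (cases "k = m")
    case True
    then show ?thesis using orthogonal_polysD(4)[OF \<pi>] by (simp add: r_def c_def)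
  next
    case False
    then show ?thesis
      using that q(1) orthogonal_polysD(1)[OF \<pi>, of m] by (simp add: r_def coeff_eq_0)
  qed
  have "weighted_integral a b \<omega> (q * r) = 0"
    by (rule orthogonal_to_lower_degree[OF p q(2) r])
  moreover have "weighted_integral a b \<omega> (\<pi> m * r) = 0"
    by (rule orthogonal_to_lower_degree[OF \<pi> _ r]) (use orthogonal_polysD(2)[OF \<pi>] in auto)
  moreover have "r * r = q * r - smult c (\<pi> m * r)"
    by (subst (1) r_def) (simp add: left_diff_distrib)
  ultimately have "weighted_integral a b \<omega> (r * r) = 0"
    by (simp add: weighted_integral_diff weighted_integral_smult)
  then have "r * r = 0" by (intro weighted_integral_nonneg_eq_0) auto
  then show ?thesis by (auto simp: r_def)
qed

text \<open>The trace of a discontinuous function on an edge takes at \<open>b\<close> the value that belongs to the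
  next edge; this single point does not affect the integrals.\<close>

lemma set_integral_cong_half_open:
  assumes h: "set_integrable lebesgue {a..b} h" and gh: "\<And>x. x \<in> {a..<b} \<Longrightarrow> g x = h x"
  shows "(LINT x:{a..b}|lebesgue. g x) = (LINT x:{a..b}|lebesgue. h x :: real)"
proof -
  have "indicator {a..b} x *\<^sub>R g x = indicator {a..b} x *\<^sub>R h x + (g b - h b) * indicator {b} x" for x
    using gh ab by (auto simp: indicator_def)
  moreover have "integrable lebesgue (\<lambda>x. indicator {a..b} x *\<^sub>R h x)"
    using h by (simp add: set_integrable_def)
  moreover have "integrable lebesgue (\<lambda>x. (g b - h b) * indicator {b} x)"
    by (intro integrable_mult_right integrable_real_indicator) auto
  ultimately show ?thesis by (simp add: set_lebesgue_integral_def)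
qed

end

section \<open>Piecewise polynomials on the boundary of a polygon\<close>

text \<open>\<open>q i\<close> is the polynomial that represents \<open>f\<close> on the half-open edge from \<open>v i\<close> to
  \<open>v (Suc i)\<close>.\<close>

definition has_pieces ::
  "real \<Rightarrow> real \<Rightarrow> nat \<Rightarrow> (nat \<Rightarrow> real^2) \<Rightarrow> (real^2 \<Rightarrow> real) \<Rightarrow> (nat \<Rightarrow> real poly) \<Rightarrow> bool" where
  "has_pieces a b N v f q \<longleftrightarrow> (\<forall>i\<in>{1..N}. \<forall>x\<in>{a..<b}. edge_trace a b v i f x = poly (q i) x)"

lemma S_spaceE:
  assumes "f \<in> S_space a b N v m"
  obtains q where "has_pieces a b N v f q" "\<And>i. i \<in> {1..N} \<Longrightarrow> degree (q i) \<le> m"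
proof -
  have "\<forall>i\<in>{1..N}. \<exists>q. degree q \<le> m \<and> (\<forall>x\<in>{a..<b}. edge_trace a b v i f x = poly q x)"
    using assms by (auto simp: S_space_def)
  then obtain q where
    "\<forall>i\<in>{1..N}. degree (q i) \<le> m \<and> (\<forall>x\<in>{a..<b}. edge_trace a b v i f x = poly (q i) x)"
    by (auto dest!: bchoice)
  then show ?thesis using that[of q] unfolding has_pieces_def by blast
qed

lemma S_spaceI:
  assumes "\<And>z. z \<notin> polygon_boundary N v \<Longrightarrow> f z = 0"
    "has_pieces a b N v f q" "\<And>i. i \<in> {1..N} \<Longrightarrow> degree (q i) \<le> m"
  shows "f \<in> S_space a b N v m"
  using assms unfolding S_space_def has_pieces_def by blast

lemma has_pieces_add:
  "has_pieces a b N v f p \<Longrightarrow> has_pieces a b N v g q \<Longrightarrow>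
    has_pieces a b N v (f + g) (\<lambda>i. p i + q i)"
  by (simp add: has_pieces_def edge_trace_def)

lemma has_pieces_scaleR:
  "has_pieces a b N v f p \<Longrightarrow> has_pieces a b N v (c *\<^sub>R f) (\<lambda>i. smult c (p i))"
  by (simp add: has_pieces_def edge_trace_def scaleR_fun_def)

lemma subspace_S_space: "subspace (S_space a b N v m)"
proof (rule subspaceI)
  show "0 \<in> S_space a b N v m"
    by (rule S_spaceI[where q = "\<lambda>_. 0"]) (auto simp: has_pieces_def edge_trace_def)
  fix f g :: "real^2 \<Rightarrow> real" and c :: real
  assume f: "f \<in> S_space a b N v m" and g: "g \<in> S_space a b N v m"
  from f obtain p where p: "has_pieces a b N v f p" "\<And>i. i \<in> {1..N} \<Longrightarrow> degree (p i) \<le> m"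
    by (rule S_spaceE) blast
  from g obtain q where q: "has_pieces a b N v g q" "\<And>i. i \<in> {1..N} \<Longrightarrow> degree (q i) \<le> m"
    by (rule S_spaceE) blast
  show "f + g \<in> S_space a b N v m"
    by (rule S_spaceI[OF _ has_pieces_add[OF p(1) q(1)]])
      (use f g p(2) q(2) in \<open>auto simp: S_space_def intro!: degree_add_le\<close>)
next
  fix f :: "real^2 \<Rightarrow> real" and c :: real
  assume f: "f \<in> S_space a b N v m"
  from f obtain p where p: "has_pieces a b N v f p" "\<And>i. i \<in> {1..N} \<Longrightarrow> degree (p i) \<le> m"
    by (rule S_spaceE) blast
  show "c *\<^sub>R f \<in> S_space a b N v m"
    by (rule S_spaceI[OF _ has_pieces_scaleR[OF p(1)]])
      (use f p(2) in \<open>auto simp: S_space_def scaleR_fun_def intro: order_trans[OF degree_smult_le]\<close>)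
qed

lemma S_space_mono:
  assumes km: "k \<le> m"
  shows "S_space a b N v k \<subseteq> S_space a b N v m"
proof
  fix f assume f: "f \<in> S_space a b N v k"
  then obtain q where "has_pieces a b N v f q" "\<And>i. i \<in> {1..N} \<Longrightarrow> degree (q i) \<le> k"
    by (rule S_spaceE) blast
  then show "f \<in> S_space a b N v m"
    using f km by (intro S_spaceI[of N v f a b q m]) (auto simp: S_space_def intro: order_trans)
qed

lemma subspace_S0_space: "subspace (S0_space a b N v m)"
proof -
  have "S0_space a b N v m
      = S_space a b N v m \<inter> {f. continuous_on (polygon_boundary N v) f}"
    by (auto simp: S0_space_def)
  moreover have "subspace {f :: real^2 \<Rightarrow> real. continuous_on (polygon_boundary N v) f}"
    by (auto simp: subspace_def zero_fun_def plus_fun_def scaleR_fun_def intro!: continuous_intros)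
  ultimately show ?thesis using subspace_S_space by (simp add: subspace_inter)
qed

lemma subspace_enriched_space:
  assumes "subspace W"
  shows "subspace (enriched_space W g)"
proof -
  have "enriched_space W g = {x + y |x y. x \<in> W \<and> y \<in> span {g}}"
    by (auto simp: enriched_space_def span_singleton)
  then show ?thesis using subspace_sums[OF assms subspace_span] by simp
qed

lemma edge_param_ends:
  assumes "a < b"
  shows "edge_param a b v i a = v i" "edge_param a b v i b = v (Suc i)"
  using assms by (simp_all add: edge_param_def)

lemma continuous_on_edge_param: "continuous_on A (edge_param a b v i)"
  unfolding edge_param_def divide_inverse by (intro continuous_intros)

lemma edge_eq_image:
  assumes "a < b"
  shows "edge v i = edge_param a b v i ` {a..b}"
proof
  show "edge v i \<subseteq> edge_param a b v i ` {a..b}"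
  proof
    fix z assume "z \<in> edge v i"
    then obtain u where u: "0 \<le> u" "u \<le> 1" "z = (1 - u) *\<^sub>R v i + u *\<^sub>R v (Suc i)"
      by (auto simp: edge_def in_segment)
    have "(b - (a + u * (b - a))) / (b - a) = 1 - u" "(a + u * (b - a) - a) / (b - a) = u"
      using assms by (simp_all add: field_simps)
    then have "z = edge_param a b v i (a + u * (b - a))"
      using u by (simp add: edge_param_def)
    moreover have "0 \<le> u * (b - a)" "u * (b - a) \<le> b - a"
      using u assms by (auto intro!: mult_left_le_one_le)
    then have "a + u * (b - a) \<in> {a..b}" unfolding atLeastAtMost_iff by linarith
    ultimately show "z \<in> edge_param a b v i ` {a..b}" by blast
  qed
  show "edge_param a b v i ` {a..b} \<subseteq> edge v i"
  proof
    fix z assume "z \<in> edge_param a b v i ` {a..b}"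
    then obtain x where x: "a \<le> x" "x \<le> b" "z = edge_param a b v i x" by auto
    have "(b - x) / (b - a) = 1 - (x - a) / (b - a)" using assms by (simp add: field_simps)
    then show "z \<in> edge v i"
      using x assms unfolding edge_def in_segment
      by (intro exI[of _ "(x - a) / (b - a)"]) (auto simp: edge_param_def)
  qed
qed

text \<open>The edges of a polygon, each parametrized affinely by \<open>[a, b]\<close>. The half-open edges partition
  the boundary.\<close>

locale parametrized_polygon =
  fixes N :: nat and v :: "nat \<Rightarrow> real^2" and a b :: real
  assumes polygon: "polygon_ccw N v" and ab: "a < b"
begin

lemma polygon_next_vertex:
  assumes "i \<in> {1..N}"
  shows "v (Suc i) \<noteq> v i" "\<exists>k\<in>{1..N}. v (Suc i) = v k"
proof -
  have *: "v (Suc N) = v 1" "inj_on v {1..N}" "3 \<le> N" using polygon by (auto simp: polygon_ccw_def)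
  have "\<exists>k\<in>{1..N}. v (Suc i) = v k \<and> k \<noteq> i"
  proof (cases "i = N")
    case True
    then show ?thesis using * by (intro bexI[of _ 1]) auto
  next
    case False
    then show ?thesis using assms by (intro bexI[of _ "Suc i"]) auto
  qed
  then show "v (Suc i) \<noteq> v i" "\<exists>k\<in>{1..N}. v (Suc i) = v k"
    using *(2) assms by (metis inj_onD, blast)
qed

lemma inj_edge_param:
  assumes "i \<in> {1..N}" "edge_param a b v i x = edge_param a b v i y"
  shows "x = y"
proof -
  have "edge_param a b v i x - edge_param a b v i y
      = ((b - x) / (b - a) - (b - y) / (b - a)) *\<^sub>R v i
        + ((x - a) / (b - a) - (y - a) / (b - a)) *\<^sub>R v (Suc i)"
    by (simp add: edge_param_def scaleR_diff_left)
  also have "(b - x) / (b - a) - (b - y) / (b - a) = - ((x - y) / (b - a))"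
    by (simp add: diff_divide_distrib[symmetric] minus_divide_left)
  also have "(x - a) / (b - a) - (y - a) / (b - a) = (x - y) / (b - a)"
    by (simp add: diff_divide_distrib[symmetric])
  also have "(- ((x - y) / (b - a))) *\<^sub>R v i + ((x - y) / (b - a)) *\<^sub>R v (Suc i)
      = ((x - y) / (b - a)) *\<^sub>R (v (Suc i) - v i)"
    by (simp add: scaleR_diff_right)
  finally have "((x - y) / (b - a)) *\<^sub>R (v (Suc i) - v i) = 0" using assms(2) by simp
  then show ?thesis using polygon_next_vertex(1)[OF assms(1)] ab by auto
qed

lemma half_open_edges_disjoint:
  assumes i: "i \<in> {1..N}" "x \<in> {a..<b}" and j: "j \<in> {1..N}" "y \<in> {a..<b}"
    and eq: "edge_param a b v i x = edge_param a b v j y"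
  shows "i = j" "x = y"
proof -
  show "i = j"
  proof (rule ccontr)
    assume ne: "i \<noteq> j"
    define z where "z = edge_param a b v i x"
    have "z \<in> edge v i"
      using i(2) unfolding z_def edge_eq_image[OF ab] by (intro imageI) auto
    moreover have "z \<in> edge v j"
      using j(2) unfolding z_def eq edge_eq_image[OF ab] by (intro imageI) auto
    ultimately have "z \<in> edge v i \<inter> edge v j" by simp
    also have "edge v i \<inter> edge v j = {v i, v (Suc i)} \<inter> {v j, v (Suc j)}"
      using polygon i(1) j(1) ne by (simp add: polygon_ccw_def)
    finally have z: "z \<in> {v i, v (Suc i)} \<inter> {v j, v (Suc j)}" .
    have "z \<noteq> v (Suc i)"
      using inj_edge_param[OF i(1), of x b] i(2) by (auto simp: z_def edge_param_ends[OF ab])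
    moreover have "z \<noteq> v (Suc j)"
      using inj_edge_param[OF j(1), of y b] j(2) by (auto simp: z_def eq edge_param_ends[OF ab])
    ultimately have "v i = v j" using z by auto
    then show False using polygon i(1) j(1) ne by (auto simp: polygon_ccw_def dest: inj_onD)
  qed
  then show "x = y" using inj_edge_param[OF i(1)] eq by simp
qed

lemma polygon_boundaryE:
  assumes "z \<in> polygon_boundary N v"
  obtains i x where "i \<in> {1..N}" "x \<in> {a..<b}" "z = edge_param a b v i x"
proof -
  obtain i x where ix: "i \<in> {1..N}" "x \<in> {a..b}" "z = edge_param a b v i x"
    using assms by (auto simp: polygon_boundary_def edge_eq_image[OF ab])
  show ?thesis
  proof (cases "x = b")
    case False
    then show ?thesis using ix that[of i x] by auto
  next
    case True
    then obtain k where "k \<in> {1..N}" "z = v k"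
      using ix polygon_next_vertex(2)[OF ix(1)] by (auto simp: edge_param_ends[OF ab])
    then show ?thesis using that[of k a] ab by (auto simp: edge_param_ends[OF ab])
  qed
qed

lemma edge_param_in_boundary:
  "i \<in> {1..N} \<Longrightarrow> x \<in> {a..b} \<Longrightarrow> edge_param a b v i x \<in> polygon_boundary N v"
  unfolding polygon_boundary_def edge_eq_image[OF ab] by (rule UN_I[of i]) (assumption | rule imageI)+

lemma S_space_eqI:
  assumes "f \<in> S_space a b N v m" "has_pieces a b N v f (\<lambda>_. 0)"
  shows "f = 0"
proof
  fix z show "f z = 0 z"
  proof (cases "z \<in> polygon_boundary N v")
    case True
    then obtain i x where "i \<in> {1..N}" "x \<in> {a..<b}" "z = edge_param a b v i x"
      by (rule polygon_boundaryE)
    then show ?thesis using assms(2) by (auto simp: has_pieces_def edge_trace_def)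
  qed (use assms in \<open>auto simp: S_space_def\<close>)
qed

text \<open>By continuity the pieces of \<open>f\<close> take the vertex values at both ends of their edges.\<close>

lemma S0_space_piece_ends:
  assumes f: "f \<in> S0_space a b N v m" and q: "has_pieces a b N v f q" and i: "i \<in> {1..N}"
  shows "poly (q i) a = f (v i)" "poly (q i) b = f (v (Suc i))"
proof -
  have eq: "f (edge_param a b v i x) - poly (q i) x = 0" if "x \<in> {a..<b}" for x
    using q i that by (auto simp: has_pieces_def edge_trace_def)
  have "continuous_on {a..b} (\<lambda>x. f (edge_param a b v i x) - poly (q i) x)"
    using f edge_param_in_boundary[OF i]
    by (intro continuous_intros continuous_on_compose2[OF _ continuous_on_edge_param])
      (auto simp: S0_space_def)
  moreover have closure: "closure {a..<b} = {a..b}" using ab by (rule closure_atLeastLessThan)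
  ultimately have "continuous_on (closure {a..<b}) (\<lambda>x. f (edge_param a b v i x) - poly (q i) x)"
    by simp
  from continuous_constant_on_closure[OF this eq, of b]
  have "f (edge_param a b v i b) - poly (q i) b = 0" using ab closure by simp
  then show "poly (q i) b = f (v (Suc i))" by (simp add: edge_param_ends[OF ab])
  show "poly (q i) a = f (v i)" using eq[of a] ab by (simp add: edge_param_ends[OF ab])
qed

text \<open>The edge index and the parameter in \<open>[a, b)\<close> of a boundary point; both are unique. A vertex
  \<open>v i\<close> is assigned to the edge that starts there. The value off the boundary is irrelevant.\<close>

definition boundary_coord :: "real^2 \<Rightarrow> nat \<times> real" where
  "boundary_coord z = (THE (i, x). i \<in> {1..N} \<and> x \<in> {a..<b} \<and> z = edge_param a b v i x)"

lemma boundary_coord_edge_param: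
  assumes "i \<in> {1..N}" "x \<in> {a..<b}"
  shows "boundary_coord (edge_param a b v i x) = (i, x)"
  unfolding boundary_coord_def
proof (rule the_equality)
  fix jy assume "case jy of (j, y) \<Rightarrow>
    j \<in> {1..N} \<and> y \<in> {a..<b} \<and> edge_param a b v i x = edge_param a b v j y"
  then show "jy = (i, x)"
    using half_open_edges_disjoint[OF assms, of "fst jy" "snd jy"] by (simp add: case_prod_beta prod_eq_iff)
qed (use assms in simp)

text \<open>A linear map from possibly discontinuous piecewise polynomials of degree at most \<open>k\<close> into
  continuous ones of degree at most \<open>Suc k\<close>: a piece \<open>q\<close> on \<open>[a, b)\<close> is sent to the linear interpolant of the right-sided
  vertex values plus \<open>(b - x) (q(x) - q(a))\<close>, which vanishes at both ends. The vertex values, and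
  then the pieces, can be recovered, so the map is injective.\<close>

definition continuous_lift :: "(real^2 \<Rightarrow> real) \<Rightarrow> real^2 \<Rightarrow> real" where
  "continuous_lift f z =
     (if z \<in> polygon_boundary N v then
        (case boundary_coord z of (i, x) \<Rightarrow>
           (b - x) / (b - a) * f (v i) + (x - a) / (b - a) * f (v (Suc i))
             + (b - x) * (f z - f (v i)))
      else 0)"

lemma continuous_lift_edge_param:
  assumes "i \<in> {1..N}" "x \<in> {a..<b}"
  shows "continuous_lift f (edge_param a b v i x)
    = (b - x) / (b - a) * f (v i) + (x - a) / (b - a) * f (v (Suc i))
        + (b - x) * (f (edge_param a b v i x) - f (v i))"
  using assms edge_param_in_boundary[of i x]
  by (simp add: continuous_lift_def boundary_coord_edge_param)

lemma continuous_lift_vertex: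
  assumes "i \<in> {1..N}"
  shows "continuous_lift f (v i) = f (v i)"
  using continuous_lift_edge_param[of i a f] assms ab by (simp add: edge_param_ends[OF ab])

lemma linear_continuous_lift: "linear continuous_lift"
  by (rule linearI)
    (auto simp: fun_eq_iff continuous_lift_def scaleR_fun_def algebra_simps add_divide_distrib diff_divide_distrib
        split: prod.splits)

lemma inj_on_continuous_lift: "inj_on continuous_lift (S_space a b N v k)"
proof -
  have "f = 0" if f: "f \<in> S_space a b N v k" and z: "continuous_lift f = 0" for f
  proof (rule S_space_eqI[OF f])
    have vert: "f (v i) = 0" if "i \<in> {1..N}" for i
      using continuous_lift_vertex[OF that, of f] z by simp
    have "f (edge_param a b v i x) = 0" if ix: "i \<in> {1..N}" "x \<in> {a..<b}" for i x
    proof -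
      have "f (v (Suc i)) = 0" using polygon_next_vertex(2)[OF ix(1)] vert by auto
      then show ?thesis
        using continuous_lift_edge_param[OF ix, of f] z vert[OF ix(1)] ix(2) by simp
    qed
    then show "has_pieces a b N v f (\<lambda>_. 0)" by (simp add: has_pieces_def edge_trace_def)
  qed
  then show ?thesis
    by (simp add: linear_injective_on_subspace_0[OF linear_continuous_lift subspace_S_space])
qed

lemma continuous_lift_in_S0_space:
  assumes f: "f \<in> S_space a b N v k"
  shows "continuous_lift f \<in> S0_space a b N v (Suc k)"
proof -
  obtain q where q: "has_pieces a b N v f q" "\<And>i. i \<in> {1..N} \<Longrightarrow> degree (q i) \<le> k"
    using f by (rule S_spaceE) blast
  define r where "r i = smult (f (v i) / (b - a)) [:b, - 1:]
    + smult (f (v (Suc i)) / (b - a)) [:- a, 1:] + [:b, - 1:] * (q i - [:f (v i):])" for i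
  have poly_r: "poly (r i) x = (b - x) / (b - a) * f (v i) + (x - a) / (b - a) * f (v (Suc i))
      + (b - x) * (poly (q i) x - f (v i))" for i x
  proof -
    have "poly [:b, - 1:] x = b - x" "poly [:- a, 1:] x = x - a" by simp_all
    then show ?thesis by (simp only: r_def poly_add poly_mult poly_diff poly_smult) (simp add: mult.commute)
  qed
  \<comment> \<open>At \<open>x = b\<close>, where the next piece is in force, this is the continuity at the vertex.\<close>
  have r: "continuous_lift f (edge_param a b v i x) = poly (r i) x"
    if ix: "i \<in> {1..N}" "x \<in> {a..b}" for i x
  proof (cases "x = b")
    case True
    obtain j where "j \<in> {1..N}" "v (Suc i) = v j" using polygon_next_vertex(2)[OF ix(1)] by blast
    then have "continuous_lift f (edge_param a b v i x) = f (v (Suc i))"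
      using continuous_lift_vertex[of j f] True by (simp add: edge_param_ends[OF ab])
    then show ?thesis using True ab by (simp add: poly_r)
  next
    case False
    then have "x \<in> {a..<b}" using ix by auto
    moreover from this have "f (edge_param a b v i x) = poly (q i) x"
      using q(1) ix(1) by (simp add: has_pieces_def edge_trace_def)
    ultimately show ?thesis
      using continuous_lift_edge_param[OF ix(1), of x f] by (simp add: poly_r)
  qed
  have deg: "degree (r i) \<le> Suc k" if "i \<in> {1..N}" for i
  proof -
    have "degree (q i - [:f (v i):]) \<le> k"
      by (rule degree_diff_le[OF q(2)[OF that]]) simp
    then have "degree ([:b, - 1:] * (q i - [:f (v i):])) \<le> Suc k"
      by (intro order_trans[OF degree_mult_le]) simp
    moreover have "degree (smult c [:b, - 1:]) \<le> Suc k" "degree (smult c [:- a, 1:]) \<le> Suc k" for c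
      by (rule order_trans[OF degree_smult_le], simp)+
    ultimately show ?thesis unfolding r_def by (intro degree_add_le)
  qed
  have "continuous_lift f \<in> S_space a b N v (Suc k)"
    by (rule S_spaceI[where q = r])
      (use r deg in \<open>auto simp: continuous_lift_def has_pieces_def edge_trace_def\<close>)
  moreover have "continuous_on (polygon_boundary N v) (continuous_lift f)"
    unfolding polygon_boundary_def
  proof (rule continuous_on_closed_Union)
    fix i assume i: "i \<in> {1..N}"
    show "closed (edge v i)" by (simp add: edge_def)
    \<comment> \<open>\<open>g\<close> is the inverse of the edge parametrization, continuous by compactness.\<close>
    define g where "g = inv_into {a..b} (edge_param a b v i)"
    have inj: "inj_on (edge_param a b v i) {a..b}"
      using inj_edge_param[OF i] by (auto intro: inj_onI)
    have g: "continuous_on (edge v i) g"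
      unfolding edge_eq_image[OF ab] g_def
      by (rule continuous_on_inv[OF continuous_on_edge_param compact_Icc]) (simp add: inj)
    have "continuous_lift f z = poly (r i) (g z)" if "z \<in> edge v i" for z
      using that r[OF i] inj by (auto simp: edge_eq_image[OF ab] g_def)
    moreover have "continuous_on (edge v i) (\<lambda>z. poly (r i) (g z))"
      using g by (intro continuous_intros)
    ultimately show "continuous_on (edge v i) (continuous_lift f)"
      by (simp cong: continuous_on_cong)
  qed simp
  ultimately show ?thesis by (simp add: S0_space_def)
qed

end

section \<open>The enriched boundary element\<close>

locale weighted_polygon = weighted_interval a b \<omega> + parametrized_polygon N v a b
  for a b :: real and \<omega> :: "real \<Rightarrow> real" and N :: nat and v :: "nat \<Rightarrow> real^2"
begin

lemma bd_functional_pieces: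
  assumes "has_pieces a b N v f p" "has_pieces a b N v g q"
  shows "bd_functional a b \<omega> N v g f = (\<Sum>i=1..N. weighted_integral a b \<omega> (p i * q i))"
  unfolding bd_functional_def weighted_integral_def
  by (intro sum.cong refl set_integral_cong_half_open set_integrable_poly_weight)
    (use assms in \<open>simp add: has_pieces_def\<close>)

lemma extra_functional_pieces:
  assumes "has_pieces a b N v f p"
  shows "extra_functional a b \<omega> N v q f
    = (\<Sum>i=1..N. (poly q b / poly q a) ^ (i - 1) * weighted_integral a b \<omega> (p i * q))"
proof -
  have "(LINT x:{a..b}|lebesgue. edge_trace a b v i f x * poly q x * \<omega> x)
      = weighted_integral a b \<omega> (p i * q)" if "i \<in> {1..N}" for i
    unfolding weighted_integral_def
    by (intro set_integral_cong_half_open set_integrable_poly_weight)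
      (use assms that in \<open>simp add: has_pieces_def\<close>)
  then show ?thesis unfolding extra_functional_def by simp
qed

lemma linear_functional_on_bd_functional:
  assumes g: "g \<in> S_space a b N v k"
  shows "linear_functional_on (S_space a b N v m) (bd_functional a b \<omega> N v g)"
  unfolding linear_functional_on_def
proof (intro conjI ballI allI)
  fix f h :: "real^2 \<Rightarrow> real" and c :: real assume f: "f \<in> S_space a b N v m"
  obtain q where q: "has_pieces a b N v g q" using g by (rule S_spaceE)
  obtain p where p: "has_pieces a b N v f p" using f by (rule S_spaceE)
  show "bd_functional a b \<omega> N v g (c *\<^sub>R f) = c * bd_functional a b \<omega> N v g f"
    by (simp add: bd_functional_pieces[OF has_pieces_scaleR[OF p] q] bd_functional_pieces[OF p q]
        weighted_integral_smult sum_distrib_left)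
  assume h: "h \<in> S_space a b N v m"
  obtain r where r: "has_pieces a b N v h r" using h by (rule S_spaceE)
  show "bd_functional a b \<omega> N v g (f + h)
      = bd_functional a b \<omega> N v g f + bd_functional a b \<omega> N v g h"
    by (simp add: bd_functional_pieces[OF has_pieces_add[OF p r] q] bd_functional_pieces[OF p q]
        bd_functional_pieces[OF r q] distrib_right weighted_integral_add sum.distrib)
qed

lemma linear_functional_on_extra_functional:
  "linear_functional_on (S_space a b N v m) (extra_functional a b \<omega> N v q)"
  unfolding linear_functional_on_def
proof (intro conjI ballI allI)
  fix f h :: "real^2 \<Rightarrow> real" and c :: real assume f: "f \<in> S_space a b N v m"
  obtain p where p: "has_pieces a b N v f p" using f by (rule S_spaceE)
  show "extra_functional a b \<omega> N v q (c *\<^sub>R f) = c * extra_functional a b \<omega> N v q f"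
    by (simp add: extra_functional_pieces[OF has_pieces_scaleR[OF p]] extra_functional_pieces[OF p]
        weighted_integral_smult sum_distrib_left mult.left_commute)
  assume h: "h \<in> S_space a b N v m"
  obtain r where r: "has_pieces a b N v h r" using h by (rule S_spaceE)
  show "extra_functional a b \<omega> N v q (f + h)
      = extra_functional a b \<omega> N v q f + extra_functional a b \<omega> N v q h"
    by (simp add: extra_functional_pieces[OF has_pieces_add[OF p r]] extra_functional_pieces[OF p]
        extra_functional_pieces[OF r] distrib_right distrib_left weighted_integral_add sum.distrib)
qed

text \<open>If all moments of degree below \<open>m\<close> vanish, the pieces are multiples \<open>c i \<cdot> \<pi> m\<close>. Continuity
  at the vertices makes \<open>c\<close> geometric with ratio \<open>\<pi> m (b) / \<pi> m (a)\<close>, so that the extra functional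
  is \<open>c 1\<close> times a positive sum of squares times \<open>\<kappa> m\<close>.\<close>

lemma S0_space_eq_0_if_moments_vanish:
  assumes \<pi>: "orthogonal_polys a b \<omega> \<pi> \<kappa>" and p: "orthogonal_polys a b \<omega> p \<kappa>'"
    and f: "f \<in> S0_space a b N v m"
    and moments: "\<And>q i k. has_pieces a b N v f q \<Longrightarrow> i \<in> {1..N} \<Longrightarrow> k < m \<Longrightarrow>
      weighted_integral a b \<omega> (q i * p k) = 0"
    and extra: "extra_functional a b \<omega> N v (\<pi> m) f = 0"
  shows "f = 0"
proof -
  have fS: "f \<in> S_space a b N v m" using f by (simp add: S0_space_def)
  obtain q where q: "has_pieces a b N v f q" "\<And>i. i \<in> {1..N} \<Longrightarrow> degree (q i) \<le> m"
    using fS by (rule S_spaceE) blast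
  have "\<forall>i\<in>{1..N}. \<exists>c. q i = smult c (\<pi> m)"
    using orthogonal_to_lower_degree_imp_multiple[OF \<pi> p q(2)] moments[OF q(1)] by blast
  then obtain c where c: "\<And>i. i \<in> {1..N} \<Longrightarrow> q i = smult (c i) (\<pi> m)"
    by (auto dest!: bchoice)
  define \<rho> where "\<rho> = poly (\<pi> m) b / poly (\<pi> m) a"
  have \<pi>a: "poly (\<pi> m) a \<noteq> 0" by (rule orthogonal_poly_endpoint_nonzero[OF \<pi>]) simp
  have N: "3 \<le> N" using polygon by (simp add: polygon_ccw_def)
  have geometric: "c (Suc n) = c 1 * \<rho> ^ n" if "Suc n \<le> N" for n
    using that
  proof (induction n)
    case (Suc n)
    have "c (Suc (Suc n)) * poly (\<pi> m) a = poly (q (Suc (Suc n))) a"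
      using c[of "Suc (Suc n)"] Suc.prems by simp
    also have "\<dots> = poly (q (Suc n)) b"
      using S0_space_piece_ends(1)[OF f q(1), of "Suc (Suc n)"]
        S0_space_piece_ends(2)[OF f q(1), of "Suc n"] Suc.prems by simp
    also have "\<dots> = c (Suc n) * poly (\<pi> m) b" using c[of "Suc n"] Suc.prems by simp
    finally have "c (Suc (Suc n)) = c (Suc n) * \<rho>" using \<pi>a by (simp add: \<rho>_def field_simps)
    then show ?case using Suc by simp
  qed simp
  have "0 = (\<Sum>i=1..N. \<rho> ^ (i - 1) * weighted_integral a b \<omega> (q i * \<pi> m))"
    using extra extra_functional_pieces[OF q(1), of "\<pi> m"] by (simp add: \<rho>_def)
  also have "\<dots> = (\<Sum>i=1..N. c 1 * \<kappa> m * (\<rho> ^ (i - 1))\<^sup>2)"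
  proof (rule sum.cong[OF refl])
    fix i assume i: "i \<in> {1..N}"
    have "c i = c 1 * \<rho> ^ (i - 1)" using geometric[of "i - 1"] i by simp
    then show "\<rho> ^ (i - 1) * weighted_integral a b \<omega> (q i * \<pi> m) = c 1 * \<kappa> m * (\<rho> ^ (i - 1))\<^sup>2"
      using c[OF i] orthogonal_polysD(2)[OF \<pi>, of m m]
      by (simp add: weighted_integral_smult power2_eq_square)
  qed
  also have "\<dots> = c 1 * \<kappa> m * (\<Sum>i=1..N. (\<rho> ^ (i - 1))\<^sup>2)" by (simp add: sum_distrib_left)
  finally have "c 1 * \<kappa> m * (\<Sum>i=1..N. (\<rho> ^ (i - 1))\<^sup>2) = 0" by simp
  moreover have "0 < (\<Sum>i=1..N. (\<rho> ^ (i - 1))\<^sup>2)"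
    using N by (intro sum_pos2[where i = 1]) auto
  ultimately have "c 1 = 0" using orthogonal_polysD(3)[OF \<pi>, of m] by auto
  then have "q i = 0" if "i \<in> {1..N}" for i
    using c[OF that] geometric[of "i - 1"] that by simp
  then have "has_pieces a b N v f (\<lambda>_. 0)" using q(1) by (simp add: has_pieces_def)
  then show ?thesis by (rule S_space_eqI[OF fS])
qed

text \<open>Applied to \<open>g + \<alpha> *\<^sub>R bas 1\<close> with \<open>g\<close> continuous, the relation \<open>d\<close> gives \<open>\<alpha> = 0\<close>, because
  \<open>bas\<close> is orthonormal; the moments and the extra functional then determine \<open>g\<close>. The lifted basis
  functions together with \<open>bas 1\<close> provide the lower bound \<open>m * N + 1\<close> for the dimension.\<close>

lemma defines_finite_element_enriched:
  assumes m: "1 \<le> m"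
    and \<pi>: "orthogonal_polys a b \<omega> \<pi> \<kappa>" and p: "orthonormal_polys a b \<omega> p"
    and inj: "inj_on bas {1..m * N}" and ind: "independent (bas ` {1..m * N})"
    and spn: "span (bas ` {1..m * N}) = S_space a b N v (m - 1)"
    and \<phi>: "bij_betw \<phi> {1..m * N} ({1..N} \<times> {0..<m})"
    and trace: "\<forall>j\<in>{1..m * N}. \<forall>i\<in>{1..N}. \<forall>x\<in>{a..<b}.
      edge_trace a b v i (bas j) x = (if i = fst (\<phi> j) then poly (p (snd (\<phi> j))) x else 0)"
    and d: "d 1 \<noteq> 0"
      "\<forall>f\<in>S0_space a b N v m. (\<Sum>j=1..m * N. d j * bd_functional a b \<omega> N v (bas j) f) = 0"
  shows "defines_finite_element (enriched_space (S0_space a b N v m) (bas 1))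
    (insert (extra_functional a b \<omega> N v (\<pi> m))
      ((\<lambda>j. bd_functional a b \<omega> N v (bas j)) ` {1..m * N}))"
proof -
  define n where "n = m * N"
  define L where "L j = bd_functional a b \<omega> N v (bas j)" for j
  define F where "F = extra_functional a b \<omega> N v (\<pi> m)"
  let ?S = "S_space a b N v m" and ?C = "S0_space a b N v m"
  let ?E = "enriched_space ?C (bas 1)"
  have "3 \<le> N" using polygon by (simp add: polygon_ccw_def)
  then have one: "1 \<in> {1..n}" using m by (simp add: n_def Suc_le_eq)
  have p': "orthogonal_polys a b \<omega> p (\<lambda>_. 1)" using p by (simp add: orthonormal_polys_def)
  have bas_lower: "bas j \<in> S_space a b N v (m - 1)" if "j \<in> {1..n}" for j
    using that span_base[of "bas j" "bas ` {1..m * N}"] unfolding spn n_def by blast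
  then have bas_S: "bas j \<in> ?S" if "j \<in> {1..n}" for j
    using that S_space_mono[of "m - 1" m a b N v] by auto
  have pieces: "has_pieces a b N v (bas j) (\<lambda>i. if i = fst (\<phi> j) then p (snd (\<phi> j)) else 0)"
    if "j \<in> {1..n}" for j
    using trace that by (auto simp: has_pieces_def n_def)
  have \<phi>_in: "fst (\<phi> j) \<in> {1..N}" if "j \<in> {1..n}" for j
    using bij_betwE[OF \<phi>] that by (auto simp: n_def mem_Times_iff)
  have L_pieces: "L j f = weighted_integral a b \<omega> (q (fst (\<phi> j)) * p (snd (\<phi> j)))"
    if f: "has_pieces a b N v f q" and j: "j \<in> {1..n}" for f q j
  proof -
    have "L j f = (\<Sum>i=1..N. if i = fst (\<phi> j)
        then weighted_integral a b \<omega> (q (fst (\<phi> j)) * p (snd (\<phi> j))) else 0)"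
      unfolding L_def bd_functional_pieces[OF f pieces[OF j]] by (intro sum.cong) auto
    then show ?thesis using \<phi>_in[OF j] by simp
  qed
  have L_bas: "L j (bas k) = (if j = k then 1 else 0)" if jk: "j \<in> {1..n}" "k \<in> {1..n}" for j k
  proof -
    have "\<phi> j = \<phi> k \<longleftrightarrow> j = k"
      using bij_betw_imp_inj_on[OF \<phi>] jk by (auto simp: n_def dest: inj_onD)
    moreover have "L j (bas k)
        = (if fst (\<phi> j) = fst (\<phi> k) \<and> snd (\<phi> k) = snd (\<phi> j) then 1 else 0)"
      using L_pieces[OF pieces[OF jk(2)] jk(1)] orthogonal_polysD(2)[OF p'] by simp
    ultimately show ?thesis by (auto simp: prod_eq_iff)
  qed
  have S0_S: "?C \<subseteq> ?S" by (auto simp: S0_space_def)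
  then have E_S: "?E \<subseteq> ?S"
    using bas_S[OF one] subspace_S_space[of a b N v m]
    by (auto simp: enriched_space_def intro!: subspace_add subspace_scale)
  have L_lin: "linear_functional_on ?S (L j)" if "j \<in> {1..n}" for j
    unfolding L_def by (rule linear_functional_on_bd_functional[OF bas_S[OF that]])
  have F_lin: "linear_functional_on ?S F"
    unfolding F_def by (rule linear_functional_on_extra_functional)
  have d_bas: "(\<Sum>j=1..n. d j * L j (bas 1)) = d 1"
  proof -
    have "(\<Sum>j=1..n. d j * L j (bas 1)) = (\<Sum>j=1..n. if j = 1 then d 1 else 0)"
      using L_bas[OF _ one] by (intro sum.cong) auto
    then show ?thesis using one by simp
  qed
  have S0_sub_E: "?C \<subseteq> ?E"
  proof
    fix f assume "f \<in> ?C"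
    then show "f \<in> ?E" unfolding enriched_space_def
      by (intro CollectI exI[of _ f] exI[of _ 0]) simp
  qed
  have bas1_E: "bas 1 \<in> ?E" unfolding enriched_space_def
    by (intro CollectI exI[of _ 0] exI[of _ 1]) (simp add: subspace_0[OF subspace_S0_space])
  have bas1_S0: "bas 1 \<notin> ?C" using d d_bas by (auto simp: L_def n_def)
  have unisolvent: "f = 0" if f: "f \<in> ?E" and Lf: "\<And>j. j \<in> {1..n} \<Longrightarrow> L j f = 0" and Ff: "F f = 0"
    for f
  proof -
    obtain g \<alpha> where g: "g \<in> ?C" "f = g + \<alpha> *\<^sub>R bas 1"
      using f by (auto simp: enriched_space_def)
    have "L j f = L j g + \<alpha> * L j (bas 1)" if j: "j \<in> {1..n}" for j
      using L_lin[OF j] g S0_S bas_S[OF one] subspace_scale[OF subspace_S_space bas_S[OF one]]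
      by (auto simp: linear_functional_on_def)
    then have "(\<Sum>j=1..n. d j * L j f) = (\<Sum>j=1..n. d j * L j g + \<alpha> * (d j * L j (bas 1)))"
      by (intro sum.cong) (auto simp: algebra_simps)
    also have "\<dots> = (\<Sum>j=1..n. d j * L j g) + \<alpha> * (\<Sum>j=1..n. d j * L j (bas 1))"
      by (simp add: sum.distrib sum_distrib_left)
    also have "\<dots> = \<alpha> * d 1" using d(2) g(1) d_bas by (simp add: L_def n_def)
    finally have "\<alpha> = 0" using Lf d(1) by simp
    then have f0: "f \<in> ?C" using g by simp
    show ?thesis
    proof (rule S0_space_eq_0_if_moments_vanish[OF \<pi> p' f0])
      show "extra_functional a b \<omega> N v (\<pi> m) f = 0" using Ff by (simp add: F_def)
      fix q i k assume q: "has_pieces a b N v f q" and i: "i \<in> {1..N}" and k: "k < m"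
      then have "(i, k) \<in> \<phi> ` {1..n}"
        using bij_betw_imp_surj_on[OF \<phi>] by (simp add: n_def)
      then obtain j where "j \<in> {1..n}" "\<phi> j = (i, k)" by (metis imageE)
      then show "weighted_integral a b \<omega> (q i * p k) = 0" using L_pieces[OF q] Lf by force
    qed
  qed
  let ?A = "continuous_lift ` bas ` {1..n}"
  have A_S0: "?A \<subseteq> ?C"
    using continuous_lift_in_S0_space[OF bas_lower] m by auto
  have inj_lift: "inj_on continuous_lift (span (bas ` {1..n}))"
    using inj_on_continuous_lift[of "m - 1"] spn by (simp add: n_def)
  have A_ind: "independent ?A"
    by (rule linear_independent_injective_image[OF linear_continuous_lift _ inj_lift])
      (use ind in \<open>simp add: n_def\<close>)
  have A_card: "card ?A = n"
    using inj_on_subset[OF inj_lift span_superset] inj by (simp add: card_image n_def)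
  have "span ?A \<subseteq> ?C" by (rule span_minimal[OF A_S0 subspace_S0_space])
  then have bas1_A: "bas 1 \<notin> span ?A" using bas1_S0 by blast
  have "defines_finite_element ?E (insert F (L ` {1..n}))"
  proof (rule defines_finite_elementI)
    show "subspace ?E" by (rule subspace_enriched_space[OF subspace_S0_space])
    show "\<forall>M\<in>insert F (L ` {1..n}). linear_functional_on ?E M"
      using linear_functional_on_subset[OF _ E_S] L_lin F_lin by auto
    show "\<forall>f\<in>?E. (\<forall>M\<in>insert F (L ` {1..n}). M f = 0) \<longrightarrow> f = 0"
      using unisolvent by blast
    show "independent (insert (bas 1) ?A)" by (rule independent_insertI[OF bas1_A A_ind])
    show "insert (bas 1) ?A \<subseteq> ?E" using bas1_E A_S0 S0_sub_E by blast
    have "card (insert F (L ` {1..n})) \<le> Suc (card (L ` {1..n}))"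
      by (rule card_insert_le_m1) simp_all
    also have "\<dots> \<le> Suc n" using card_image_le[of "{1..n}" L] by simp
    also have "Suc n = card (insert (bas 1) ?A)"
      using bas1_A span_base[of "bas 1" ?A] A_card by (subst card_insert_disjoint) auto
    finally show "card (insert F (L ` {1..n})) \<le> card (insert (bas 1) ?A)" .
  qed simp
  then show ?thesis by (simp add: F_def L_def[abs_def] n_def)
qed

end

theorem theorem6:
  fixes m N S :: nat
    and a b :: real
    and \<omega> :: "real \<Rightarrow> real"
    and \<pi> \<pi>hat :: "nat \<Rightarrow> real poly"
    and \<kappa> :: "nat \<Rightarrow> real"
    and v :: "nat \<Rightarrow> real^2"
    and K :: "(real^2) set"
    and bas :: "nat \<Rightarrow> real^2 \<Rightarrow> real"
    and V V0 S0 :: "(real^2 \<Rightarrow> real) set"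
    and Z :: "(real^2) set"
    and I :: "nat \<Rightarrow> (real^2 \<Rightarrow> real) \<Rightarrow> real"
    and L :: "nat \<Rightarrow> (real^2 \<Rightarrow> real) \<Rightarrow> real"
    and F :: "(real^2 \<Rightarrow> real) \<Rightarrow> real"
  assumes m: "1 \<le> m"
    and polygon: "polygon_ccw N v" "K = polygon_region N v"
    and ab: "a < b"
    and weight: "weight_function a b \<omega>"
    and orth: "orthogonal_polys a b \<omega> \<pi> \<kappa>"
    and orthonormal: "orthonormal_polys a b \<omega> \<pi>hat"
    and basis: "inj_on bas {1..m * N}" "independent (bas ` {1..m * N})"
               "span (bas ` {1..m * N}) = S_space a b N v (m - 1)"
    and S0: "S0 = S0_space a b N v m"
    and L: "\<And>j. L j = bd_functional a b \<omega> N v (bas j)"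
    and F: "F = extra_functional a b \<omega> N v (\<pi> m)"
    and lagrange: "lagrange_element K m V Z"
    and V0: "V0 = zero_boundary_space N v V"
    and interior: "inj_on I {1..S}" "I ` {1..S} \<subseteq> node_functionals Z"
                  "defines_finite_element V0 (I ` {1..S})"
  shows
    "(defines_finite_element S0 (L ` {1..m * N}) \<longrightarrow>
       (\<forall>J. extends_interior S V0 (combined_space V0 S0) I J \<longrightarrow>
          defines_finite_element (combined_space V0 S0)
            (J ` {1..S} \<union> on_boundary ` L ` {1..m * N}))) \<and>
     (\<not> defines_finite_element S0 (L ` {1..m * N}) \<longrightarrow>
       (\<forall>(\<phi> :: nat \<Rightarrow> nat \<times> nat) (d :: nat \<Rightarrow> real) J.
          bij_betw \<phi> {1..m * N} ({1..N} \<times> {0..<m}) \<longrightarrow>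
          (\<forall>j\<in>{1..m * N}. \<forall>i\<in>{1..N}. \<forall>x\<in>{a..<b}.
             edge_trace a b v i (bas j) x
               = (if i = fst (\<phi> j) then poly (\<pi>hat (snd (\<phi> j))) x else 0)) \<longrightarrow>
          d 1 \<noteq> 0 \<longrightarrow>
          (\<forall>f\<in>S0. (\<Sum>j=1..m * N. d j * L j f) = 0) \<longrightarrow>
          extends_interior S V0 (combined_space V0 (enriched_space S0 (bas 1))) I J \<longrightarrow>
          defines_finite_element (combined_space V0 (enriched_space S0 (bas 1)))
            (J ` {1..S} \<union> on_boundary ` L ` {1..m * N} \<union> {on_boundary F})))"
proof -
  interpret weighted_polygon a b \<omega> N v
    using ab weight polygon(1) by unfold_locales
  have L': "L = (\<lambda>j. bd_functional a b \<omega> N v (bas j))" using L by blast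
  have "defines_finite_element (combined_space V0 S0)
      (J ` {1..S} \<union> on_boundary ` L ` {1..m * N})"
    if "defines_finite_element S0 (L ` {1..m * N})"
      "extends_interior S V0 (combined_space V0 S0) I J" for J
    by (rule defines_finite_element_combined[OF interior(3) that interior(1)])
  moreover have "defines_finite_element (combined_space V0 (enriched_space S0 (bas 1)))
      (J ` {1..S} \<union> on_boundary ` L ` {1..m * N} \<union> {on_boundary F})"
    if "bij_betw \<phi> {1..m * N} ({1..N} \<times> {0..<m})"
      "\<forall>j\<in>{1..m * N}. \<forall>i\<in>{1..N}. \<forall>x\<in>{a..<b}. edge_trace a b v i (bas j) x
        = (if i = fst (\<phi> j) then poly (\<pi>hat (snd (\<phi> j))) x else 0)"
      "d 1 \<noteq> 0" "\<forall>f\<in>S0. (\<Sum>j=1..m * N. d j * L j f) = 0"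
      and J: "extends_interior S V0 (combined_space V0 (enriched_space S0 (bas 1))) I J"
    for \<phi> :: "nat \<Rightarrow> nat \<times> nat" and d :: "nat \<Rightarrow> real" and J
  proof -
    have "defines_finite_element (enriched_space S0 (bas 1)) (insert F (L ` {1..m * N}))"
      unfolding S0 F L'
    proof (rule defines_finite_element_enriched[where \<phi> = \<phi> and d = d])
      show "\<forall>f\<in>S0_space a b N v m. (\<Sum>j=1..m * N. d j * bd_functional a b \<omega> N v (bas j) f) = 0"
        using that(4) by (simp add: S0 L)
    qed (fact m orth orthonormal basis that(1,2,3))+
    from defines_finite_element_combined[OF interior(3) this J interior(1)] show ?thesis
      by (simp add: Un_insert_right)
  qed
  ultimately show ?thesis by blast
qed

end
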